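(* Let $X$ be a compact metric space, $\mu$ a Borel probability measure on $X$ and $f:X\to X$ a measurable map (not necessarily preserving $\mu$). Suppose that the $2^{nd}$-metric emergence of $f$ is finite, i.e. $$N:=\limsup_{\epsilon\to 0}\mathscr E'_\mu(f)(\epsilon)<\infty .$$ Then there are exactly $N$ probability measures on $X$ whose basins cover $\mu$-a.e. point of $X$; that is, there are $N$ probability measures $\mu_1,\dots,\mu_N$ on $X$ such that $\mu$-a.e. $x\in X$ belongs to the basin of some $\mu_j$, and no family of fewer than $N$ probability measures has this property.
   Context: $\mathcal M(X)$ denotes the space of Borel probability measures on $X$, endowed with the Kantorovich–Wasserstein distance $\mathsf d(\mu_1,\mu_2)=\sup_{\phi}\int_X\phi\,d(\mu_1-\mu_2)$, the supremum being over $1$-Lipschitz functions $\phi:X\to\mathbb R$ (it induces the weak-$\star$ topology). The $n$-th empirical measure at $x$ is $\mathsf e^f_n(x)=\frac1n\sum_{0\le k<n}\delta_{f^k(x)}$. The $2^{nd}$-metric emergence $\mathscr E'_\mu(f)$ is the function associating to $\epsilon>0$ the minimal number $N$ of probability measures $\mu_1,\dots,\mu_N$ on $X$ such that $\int\limsup_{n\to\infty}\min_{1\le j\le N}\mathsf d(\mathsf e^f_n(x),\mu_j)\,d\mu(x)<\epsilon$. The basin of a probability measure $\mu_j$ is the set of points $x\in X$ such that $\mathsf e^f_n(x)\to\mu_j$ as $n\to\infty$. *)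

theory Defs
  imports "HOL-Probability.Probability"
begin

text \<open>Throughout, the compact metric space \<open>X\<close> is a metric type \<open>'a\<close> whose universe is compact, and
  \<open>\<M>(X)\<close> is \<^term>\<open>space (prob_algebra borel)\<close>, i.e. all \<open>\<nu>\<close> with \<^prop>\<open>prob_space \<nu>\<close> and
  \<^prop>\<open>sets \<nu> = sets borel\<close>.\<close>

abbreviation prob_measures :: "'a::topological_space measure set" where
  "prob_measures \<equiv> space (prob_algebra borel)"

text \<open>The supremum is that of the reals, which is meaningful only for a bounded set; on a compact space
  the set is bounded by the diameter, because adding a constant to \<open>\<phi>\<close> does not change the difference.\<close>

definition wdist :: "'a::metric_space measure \<Rightarrow> 'a measure \<Rightarrow> real" where
  "wdist \<mu> \<nu> = (SUP \<phi>\<in>{\<phi> :: 'a \<Rightarrow> real. 1-lipschitz_on UNIV \<phi>}. (\<integral>x. \<phi> x \<partial>\<mu>) - (\<integral>x. \<phi> x \<partial>\<nu>))"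

text \<open>For \<open>n = 0\<close> this is the zero measure, which is irrelevant to the limits below.\<close>

definition empirical :: "('a::topological_space \<Rightarrow> 'a) \<Rightarrow> nat \<Rightarrow> 'a \<Rightarrow> 'a measure" where
  "empirical f n x =
     measure_of UNIV (sets borel) (\<lambda>A. (\<Sum>k<n. emeasure (return borel ((f ^^ k) x)) A) / of_nat n)"

lemma space_empirical [simp]: "space (empirical f n x) = UNIV"
  by (simp add: empirical_def)

lemma sets_empirical [simp, measurable_cong]:
  fixes x :: "'a::topological_space"
  shows "sets (empirical f n x) = sets borel"
  using sets.sigma_sets_eq[of "borel :: 'a measure"]
  by (simp add: empirical_def)

lemma emeasure_empirical:
  assumes "A \<in> sets borel"
  shows "emeasure (empirical f n x) A = (\<Sum>k<n. indicator A ((f ^^ k) x)) / of_nat n"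
proof -
  let ?m = "\<lambda>A. (\<Sum>k<n. emeasure (return borel ((f ^^ k) x)) A) / (of_nat n :: ennreal)"
  have "countably_additive (sets borel) ?m"
  proof (rule countably_additiveI)
    fix B :: "nat \<Rightarrow> 'a set"
    assume B: "range B \<subseteq> sets borel" "disjoint_family B" "(\<Union>i. B i) \<in> sets borel"
    have "(\<Sum>i. ?m (B i)) = (\<Sum>i. \<Sum>k<n. emeasure (return borel ((f ^^ k) x)) (B i)) / of_nat n"
      by (simp add: divide_ennreal_def)
    also have "(\<Sum>i. \<Sum>k<n. emeasure (return borel ((f ^^ k) x)) (B i)) =
               (\<Sum>k<n. \<Sum>i. emeasure (return borel ((f ^^ k) x)) (B i))"
      by (rule suminf_sum) simp
    also have "\<dots> = (\<Sum>k<n. emeasure (return borel ((f ^^ k) x)) (\<Union>i. B i))"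
      using B by (intro sum.cong refl suminf_emeasure) auto
    finally show "(\<Sum>i. ?m (B i)) = ?m (\<Union>i. B i)" .
  qed
  moreover have "positive (sets borel) ?m"
    by (simp add: positive_def)
  ultimately have "emeasure (empirical f n x) A = ?m A"
    using assms by (intro emeasure_measure_of[OF empirical_def]) auto
  then show ?thesis
    using assms by simp
qed

lemma empirical_in_prob_measures:
  assumes "n > 0"
  shows "empirical f n x \<in> prob_measures"
proof -
  have "emeasure (empirical f n x) UNIV = 1"
    using assms by (simp add: emeasure_empirical ennreal_divide_self of_nat_less_top)
  then show ?thesis
    by (auto simp: space_prob_algebra intro: prob_spaceI)
qed

definition basin :: "('a::metric_space \<Rightarrow> 'a) \<Rightarrow> 'a measure \<Rightarrow> 'a set" where
  "basin f \<nu> = {x. (\<lambda>n. wdist (empirical f n x) \<nu>) \<longlonglongrightarrow> 0}"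

text \<open>The minimum over \<open>j\<close> is written as an infimum in \<^typ>\<open>ennreal\<close>: it is attained for \<open>N > 0\<close>, and is
  \<open>\<infinity>\<close> for \<open>N = 0\<close>, so that the empty family is never admissible.\<close>

definition metric_emergence2 :: "('a::metric_space \<Rightarrow> 'a) \<Rightarrow> 'a measure \<Rightarrow> real \<Rightarrow> enat" where
  "metric_emergence2 f \<mu> \<epsilon> =
     (INF N\<in>{N :: nat. \<exists>\<nu> :: nat \<Rightarrow> 'a measure. (\<forall>j<N. \<nu> j \<in> prob_measures) \<and>
        (\<integral>\<^sup>+x. limsup (\<lambda>n. INF j\<in>{..<N}. ennreal (wdist (empirical f n x) (\<nu> j))) \<partial>\<mu>) < ennreal \<epsilon>}.
      enat N)"

definition basins_cover ::
  "('a::metric_space \<Rightarrow> 'a) \<Rightarrow> 'a measure \<Rightarrow> nat \<Rightarrow> (nat \<Rightarrow> 'a measure) \<Rightarrow> bool" where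
  "basins_cover f \<mu> N \<nu> \<longleftrightarrow>
     (\<forall>j<N. \<nu> j \<in> prob_measures) \<and> (AE x in \<mu>. \<exists>j<N. x \<in> basin f (\<nu> j))"

end

theory Submission
  imports Defs
begin

text \<open>The limit distance of a point \<open>x\<close> to a family \<open>\<nu>\<^sub>0, \<dots>, \<nu>\<^sub>N\<^sub>-\<^sub>1\<close> of probability measures is the upper limit
  of \<open>min\<^sub>j d(e\<^sub>n(x), \<nu>\<^sub>j)\<close>, so the emergence at \<open>\<epsilon>\<close> is the least size of a family whose limit distance has
  integral below \<open>\<epsilon>\<close>. The theorem follows from an equivalence, \<open>basins_cover_iff\<close>: some \<open>N\<close> measures have
  basins that cover almost every point if and only if the emergence is at most \<open>N\<close> for all small \<open>\<epsilon>\<close>.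
  Hence the value of the upper limit is the least size of a covering family, and a covering family of
  least size cannot repeat a measure.

  If basins cover, the limit distance vanishes almost everywhere. Conversely, let families of size \<open>N\<close>
  be given whose limit distances have integrals tending to 0. Since the space of probability measures is
  compact (\<open>prob_measures_seq_compact\<close>), one subsequence makes all \<open>N\<close> members converge. Moving the members
  of a family by at most \<open>c\<close> moves the limit distance by at most \<open>c\<close> (\<open>limit_dist_perturb\<close>), so the limit
  distance to the limit family has integral 0 and vanishes almost everywhere. At such a point the empirical
  measures approach a finite set, and consecutive ones differ by at most \<open>diam X / (n + 1)\<close>. They can
  therefore not keep jumping between separated members, and converge to one of them
  (\<open>wdist_tendsto_one_of_finitely_many\<close>): the point lies in a basin.

  Concluding that a nonnegative function vanishes almost everywhere because its integral is 0 requires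
  the function to be measurable. The Wasserstein distance is a supremum over an uncountable family, so
  this rests on a countable family of Lipschitz functions that is uniformly dense
  (\<open>countable_dense_lipschitz\<close>).

  Compactness of the space of probability measures is reduced to the real line. A Borel function \<open>s\<close> that
  records in its base-three digits which balls contain a point is injective with uniformly continuous
  inverse (\<open>real_coding\<close>). The images under \<open>s\<close> of discretised measures have a weakly convergent subsequence by
  Helly's theorem; Skorohod's theorem realises it by random variables that converge everywhere.
  Decoding these gives random points of \<open>X\<close> that converge, and the law of the limit is the desired
  measure. The coupling bounds \<open>\<integral>\<phi> d\<mu>\<^sub>n - \<integral>\<phi> d\<nu>\<close> for all 1-Lipschitz \<open>\<phi>\<close> at once, so it yields
  convergence in the Wasserstein distance and not only convergence of each integral.\<close>

section \<open>Lipschitz functions and empirical averages\<close>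

lemma prob_measuresD:
  assumes "\<mu> \<in> prob_measures"
  shows "prob_space \<mu>" "sets \<mu> = sets borel" "space \<mu> = UNIV"
  using assms sets_eq_imp_space_eq[of \<mu> borel] by (auto simp: space_prob_algebra)

lemma lipschitz1_iff:
  "1-lipschitz_on UNIV (\<phi> :: 'a::metric_space \<Rightarrow> real) \<longleftrightarrow> (\<forall>x y. \<bar>\<phi> x - \<phi> y\<bar> \<le> dist x y)"
  by (auto simp: lipschitz_on_def dist_real_def)

lemma lipschitz1_borel: "1-lipschitz_on UNIV (\<phi> :: 'a::metric_space \<Rightarrow> real) \<Longrightarrow> \<phi> \<in> borel_measurable borel"
  by (intro borel_measurable_continuous_onI lipschitz_on_continuous_on)

text \<open>The empirical measure is the law of \<open>f\<^sup>k(x)\<close> for \<open>k\<close> uniform on \<open>{..<n}\<close>.\<close>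
lemma integral_empirical:
  assumes "n > 0" "(\<phi> :: 'a::metric_space \<Rightarrow> real) \<in> borel_measurable borel"
  shows "(\<integral>y. \<phi> y \<partial>empirical f n x) = (\<Sum>k<n. \<phi> ((f ^^ k) x)) / (of_nat n :: real)"
proof -
  have ne: "{..<n} \<noteq> {}" using assms(1) by auto
  let ?p = "measure_pmf (pmf_of_set {..<n})"
  have "empirical f n x = distr ?p borel (\<lambda>k. (f ^^ k) x)"
  proof (rule measure_eqI)
    fix A assume "A \<in> sets (empirical f n x)"
    then have A: "A \<in> sets borel" by simp
    have "(\<Sum>k<n. indicator A ((f ^^ k) x)) = (of_nat (card ({..<n} \<inter> (\<lambda>k. (f ^^ k) x) -` A)) :: ennreal)"
      by (simp add: indicator_def sum.If_cases vimage_def Int_def)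
    then show "emeasure (empirical f n x) A = emeasure (distr ?p borel (\<lambda>k. (f ^^ k) x)) A"
      using A ne assms(1)
      by (simp add: emeasure_empirical emeasure_distr emeasure_pmf_of_set divide_ennreal[symmetric] ennreal_of_nat_eq_real_of_nat)
  qed simp
  then show ?thesis
    using assms ne by (simp add: integral_distr integral_pmf_of_set)
qed

section \<open>Base-three expansions with digits 0 and 1\<close>

lemma summable_bounded_digits:
  fixes a :: "nat \<Rightarrow> real"
  assumes "\<And>n. \<bar>a n\<bar> \<le> 1"
  shows "summable (\<lambda>n. a n / 3 ^ n)"
proof (rule summable_comparison_test')
  show "summable (\<lambda>n. (1 / 3 :: real) ^ n)" by simp
  show "norm (a n / 3 ^ n) \<le> (1 / 3) ^ n" if "n \<ge> 0" for n
    using assms[of n] by (simp add: power_divide divide_right_mono)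
qed

text \<open>At the first place \<open>i\<close> where the digits differ, the partial sums are \<open>1 / 3\<^sup>i\<close> apart, while all later places
  together contribute at most half of that. In base two the later places could cancel the difference
  completely, and close numbers would not need to share any digits.\<close>
lemma ternary_digits_eq:
  fixes a b :: "nat \<Rightarrow> real"
  assumes a: "\<And>n. a n \<in> {0, 1}" and b: "\<And>n. b n \<in> {0, 1}"
    and close: "\<bar>(\<Sum>n. a n / 3 ^ n) - (\<Sum>n. b n / 3 ^ n)\<bar> < 1 / (2 * 3 ^ K)"
    and "n \<le> K"
  shows "a n = b n"
proof (rule ccontr)
  assume "a n \<noteq> b n"
  define i where "i = (LEAST i. a i \<noteq> b i)"
  have i: "a i \<noteq> b i" "i \<le> n"
    unfolding i_def using \<open>a n \<noteq> b n\<close> by (rule LeastI, rule Least_le)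
  have before: "a j = b j" if "j < i" for j
    using that not_less_Least unfolding i_def by blast
  define c where "c j = (a j - b j) / 3 ^ j" for j
  have digit: "\<bar>a j - b j\<bar> \<le> 1" for j
    using a[of j] b[of j] by auto
  have c_sum: "summable c"
    unfolding c_def using digit by (rule summable_bounded_digits)
  have c_le: "\<bar>c j\<bar> \<le> (1 / 3) ^ j" for j
    using digit[of j] by (simp add: c_def power_divide divide_right_mono)
  have geo: "summable (\<lambda>j. (1 / 3 :: real) ^ (j + Suc i))"
    by (rule summable_ignore_initial_segment) simp
  have "\<bar>\<Sum>j. c (j + Suc i)\<bar> \<le> (\<Sum>j. (1 / 3) ^ (j + Suc i))"
  proof -
    have abs: "summable (\<lambda>j. \<bar>c (j + Suc i)\<bar>)"
      by (rule summable_comparison_test'[OF geo]) (simp add: c_le del: power_Suc add_Suc_right)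
    then show ?thesis
      by (intro order_trans[OF summable_rabs[OF abs]] suminf_le c_le geo)
  qed
  also have "\<dots> = (\<Sum>j. (1 / 3) ^ Suc i * (1 / 3) ^ j)"
    by (simp only: power_add mult.commute)
  also have "\<dots> = 1 / (2 * 3 ^ i)"
    by (subst suminf_mult) (auto simp: suminf_geometric power_divide)
  finally have tail: "\<bar>\<Sum>j. c (j + Suc i)\<bar> \<le> 1 / (2 * 3 ^ i)" .
  have "(\<Sum>n. a n / 3 ^ n) - (\<Sum>n. b n / 3 ^ n) = suminf c"
    unfolding c_def diff_divide_distrib
  proof (rule suminf_diff)
    have "\<bar>a j\<bar> \<le> 1" "\<bar>b j\<bar> \<le> 1" for j
      using a[of j] b[of j] by auto
    then show "summable (\<lambda>n. a n / 3 ^ n)" "summable (\<lambda>n. b n / 3 ^ n)"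
      by (intro summable_bounded_digits; simp)+
  qed
  also have "\<dots> = (\<Sum>j. c (j + Suc i)) + (\<Sum>j<Suc i. c j)"
    using c_sum by (rule suminf_split_initial_segment)
  also have "(\<Sum>j<Suc i. c j) = c i"
    using before by (simp add: c_def)
  finally have eq: "(\<Sum>n. a n / 3 ^ n) - (\<Sum>n. b n / 3 ^ n) = (\<Sum>j. c (j + Suc i)) + c i" .
  have "\<bar>c i\<bar> = 1 / 3 ^ i"
    using i(1) a[of i] b[of i] by (auto simp: c_def)
  then have "1 / 3 ^ i - 1 / (2 * 3 ^ i) < 1 / (2 * 3 ^ K :: real)"
    using close tail unfolding eq by linarith
  moreover have "1 / (2 * 3 ^ K :: real) \<le> 1 / (2 * 3 ^ i)"
    using i(2) \<open>n \<le> K\<close> by (intro divide_left_mono) auto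
  ultimately show False by (simp add: field_simps)
qed

section \<open>Emergence as an integral of limit distances\<close>

definition limit_dist :: "('a::metric_space \<Rightarrow> 'a) \<Rightarrow> nat \<Rightarrow> (nat \<Rightarrow> 'a measure) \<Rightarrow> 'a \<Rightarrow> ennreal" where
  "limit_dist f N \<nu> x = limsup (\<lambda>n. INF j\<in>{..<N}. ennreal (wdist (empirical f n x) (\<nu> j)))"

text \<open>Enlarging a family can only decrease the limit distance, so the least admissible size is at most \<open>N\<close>
  exactly if the size \<open>N\<close> is itself admissible.\<close>
lemma metric_emergence2_le_iff:
  fixes f :: "'a::metric_space \<Rightarrow> 'a"
  assumes "\<mu> \<in> prob_measures"
  shows "metric_emergence2 f \<mu> \<epsilon> \<le> enat N \<longleftrightarrow>
    (\<exists>\<nu>. (\<forall>j<N. \<nu> j \<in> prob_measures) \<and> (\<integral>\<^sup>+x. limit_dist f N \<nu> x \<partial>\<mu>) < ennreal \<epsilon>)"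
    (is "_ \<longleftrightarrow> (\<exists>\<nu>. ?P N \<nu>)")
proof -
  have E: "metric_emergence2 f \<mu> \<epsilon> = (INF N\<in>{N. \<exists>\<nu>. ?P N \<nu>}. enat N)"
    by (simp add: metric_emergence2_def limit_dist_def)
  show ?thesis
  proof
    assume "metric_emergence2 f \<mu> \<epsilon> \<le> enat N"
    then have "metric_emergence2 f \<mu> \<epsilon> < enat (Suc N)"
      by (rule le_less_trans) simp
    then obtain M \<nu> where M: "M \<le> N" and \<nu>: "?P M \<nu>"
      unfolding E INF_less_iff by (auto simp: less_Suc_eq_le)
    \<comment> \<open>Any probability measure serves as padding; \<open>\<mu>\<close> is one at hand.\<close>
    define \<nu>' where "\<nu>' j = (if j < M then \<nu> j else \<mu>)" for j
    have "(INF j\<in>{..<N}. ennreal (wdist (empirical f n x) (\<nu>' j))) \<le> (INF j\<in>{..<M}. ennreal (wdist (empirical f n x) (\<nu> j)))" for n x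
      using M by (intro INF_superset_mono) (auto simp: \<nu>'_def)
    then have "limit_dist f N \<nu>' x \<le> limit_dist f M \<nu> x" for x
      unfolding limit_dist_def by (intro Limsup_mono always_eventually) auto
    then have "(\<integral>\<^sup>+x. limit_dist f N \<nu>' x \<partial>\<mu>) \<le> (\<integral>\<^sup>+x. limit_dist f M \<nu> x \<partial>\<mu>)"
      by (intro nn_integral_mono)
    then have "(\<integral>\<^sup>+x. limit_dist f N \<nu>' x \<partial>\<mu>) < ennreal \<epsilon>"
      using \<nu> by auto
    moreover have "\<forall>j<N. \<nu>' j \<in> prob_measures"
      using \<nu> assms by (auto simp: \<nu>'_def)
    ultimately show "\<exists>\<nu>. ?P N \<nu>" by blast
  next
    assume "\<exists>\<nu>. ?P N \<nu>"
    then show "metric_emergence2 f \<mu> \<epsilon> \<le> enat N"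
      unfolding E by (intro INF_lower) auto
  qed
qed

context
  assumes compact_UNIV: "compact (UNIV :: 'a::metric_space set)"
begin

section \<open>The Wasserstein pseudometric on a compact space\<close>

lemma dist_le_diam: "dist (x::'a) y \<le> diameter (UNIV :: 'a set)"
  using diameter_bounded_bound[OF compact_imp_bounded[OF compact_UNIV]] by auto

lemma lipschitz_osc_le_diameter:
  "1-lipschitz_on UNIV (\<phi> :: 'a \<Rightarrow> real) \<Longrightarrow> \<bar>\<phi> x - \<phi> y\<bar> \<le> diameter (UNIV :: 'a set)"
  unfolding lipschitz1_iff using dist_le_diam order_trans by blast

lemma integrable_lipschitz:
  assumes "\<mu> \<in> prob_measures" "1-lipschitz_on UNIV (\<phi> :: 'a \<Rightarrow> real)"
  shows "integrable \<mu> \<phi>"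
proof -
  interpret prob_space \<mu> using prob_measuresD[OF assms(1)] by simp
  have "continuous_on UNIV \<phi>"
    using assms(2) by (rule lipschitz_on_continuous_on)
  then have "\<phi> \<in> borel_measurable \<mu>"
    using prob_measuresD(2)[OF assms(1)] 
    by (simp add: borel_measurable_continuous_onI cong: measurable_cong_sets)
  moreover have "norm (\<phi> x) \<le> \<bar>\<phi> undefined\<bar> + diameter (UNIV :: 'a set)" for x
    using lipschitz_osc_le_diameter[OF assms(2), of x undefined] by simp
  ultimately show ?thesis
    by (intro integrable_const_bound[where B = "\<bar>\<phi> undefined\<bar> + diameter (UNIV :: 'a set)"]) auto
qed

text \<open>Lipschitz functions may be unbounded as a family, since constants can be added, but their
  deviation from a value is at most the diameter. This is what makes the supremum that defines the
  Wasserstein distance finite.\<close>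
lemma integral_lipschitz_bounds:
  assumes "\<mu> \<in> prob_measures" "1-lipschitz_on UNIV (\<phi> :: 'a \<Rightarrow> real)"
  shows "\<bar>(\<integral>x. \<phi> x \<partial>\<mu>) - \<phi> a\<bar> \<le> diameter (UNIV :: 'a set)"
proof -
  interpret prob_space \<mu> using prob_measuresD[OF assms(1)] by simp
  have int: "integrable \<mu> \<phi>" by (rule integrable_lipschitz[OF assms])
  have "\<bar>\<phi> x - \<phi> a\<bar> \<le> diameter (UNIV :: 'a set)" for x
    by (rule lipschitz_osc_le_diameter[OF assms(2)])
  then have "\<bar>\<integral>x. \<phi> x - \<phi> a \<partial>\<mu>\<bar> \<le> (\<integral>x. diameter (UNIV :: 'a set) \<partial>\<mu>)"
    using int by (intro integral_abs_bound[THEN order_trans] integral_mono) auto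
  then show ?thesis
    using int by (simp add: prob_space)
qed

lemma bdd_above_wdist:
  assumes "\<mu> \<in> prob_measures" "\<nu> \<in> prob_measures"
  shows "bdd_above ((\<lambda>\<phi>. (\<integral>x. \<phi> x \<partial>\<mu>) - (\<integral>x. \<phi> x \<partial>\<nu>)) ` {\<phi> :: 'a \<Rightarrow> real. 1-lipschitz_on UNIV \<phi>})"
proof (rule bdd_aboveI2)
  fix \<phi> :: "'a \<Rightarrow> real" assume "\<phi> \<in> {\<phi>. 1-lipschitz_on UNIV \<phi>}"
  then show "(\<integral>x. \<phi> x \<partial>\<mu>) - (\<integral>x. \<phi> x \<partial>\<nu>) \<le> 2 * diameter (UNIV :: 'a set)"
    using integral_lipschitz_bounds[OF assms(1), of \<phi> undefined]
      integral_lipschitz_bounds[OF assms(2), of \<phi> undefined] by (auto simp: abs_le_iff)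
qed

lemma integral_diff_le_wdist:
  assumes "\<mu> \<in> prob_measures" "\<nu> \<in> prob_measures" "1-lipschitz_on UNIV (\<phi> :: 'a \<Rightarrow> real)"
  shows "(\<integral>x. \<phi> x \<partial>\<mu>) - (\<integral>x. \<phi> x \<partial>\<nu>) \<le> wdist \<mu> \<nu>"
  unfolding wdist_def using assms by (intro cSUP_upper bdd_above_wdist) auto

lemma wdist_leI:
  assumes "\<And>\<phi> :: 'a \<Rightarrow> real. 1-lipschitz_on UNIV \<phi> \<Longrightarrow> (\<integral>x. \<phi> x \<partial>\<mu>) - (\<integral>x. \<phi> x \<partial>\<nu>) \<le> c"
  shows "wdist \<mu> \<nu> \<le> c"
proof -
  have "1-lipschitz_on UNIV (\<lambda>_::'a. 0::real)" by (simp add: lipschitz1_iff)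
  then show ?thesis
    unfolding wdist_def using assms by (intro cSUP_least) auto
qed

lemma wdist_nonneg:
  assumes "\<mu> \<in> prob_measures" "\<nu> \<in> prob_measures"
  shows "0 \<le> wdist \<mu> (\<nu> :: 'a measure)"
  using integral_diff_le_wdist[OF assms, of "\<lambda>_. 0"] by (simp add: lipschitz1_iff)

lemma wdist_commute:
  assumes "\<mu> \<in> prob_measures" "\<nu> \<in> prob_measures"
  shows "wdist \<mu> \<nu> = wdist \<nu> (\<mu> :: 'a measure)"
proof -
  have le: "wdist \<mu> \<nu> \<le> wdist \<nu> \<mu>" if "\<mu> \<in> prob_measures" "\<nu> \<in> prob_measures" for \<mu> \<nu> :: "'a measure"
  proof (rule wdist_leI)
    fix \<phi> :: "'a \<Rightarrow> real" assume "1-lipschitz_on UNIV \<phi>"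
    then have "1-lipschitz_on UNIV (\<lambda>x. - \<phi> x)"
      by (simp add: lipschitz1_iff abs_minus_commute)
    from integral_diff_le_wdist[OF that(2,1) this]
    show "(\<integral>x. \<phi> x \<partial>\<mu>) - (\<integral>x. \<phi> x \<partial>\<nu>) \<le> wdist \<nu> \<mu>" by simp
  qed
  show ?thesis using le[OF assms] le[OF assms(2,1)] by simp
qed

lemma wdist_triangle:
  assumes "\<mu> \<in> prob_measures" "\<nu> \<in> prob_measures" "\<rho> \<in> prob_measures"
  shows "wdist \<mu> (\<rho> :: 'a measure) \<le> wdist \<mu> \<nu> + wdist \<nu> \<rho>"
proof (rule wdist_leI)
  fix \<phi> :: "'a \<Rightarrow> real" assume "1-lipschitz_on UNIV \<phi>"
  then show "(\<integral>x. \<phi> x \<partial>\<mu>) - (\<integral>x. \<phi> x \<partial>\<rho>) \<le> wdist \<mu> \<nu> + wdist \<nu> \<rho>"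
    using integral_diff_le_wdist[OF assms(1,2)] integral_diff_le_wdist[OF assms(2,3)] by fastforce
qed

text \<open>The integral over \<open>n + 1\<close> orbit points is the mean over the first \<open>n\<close> moved by \<open>1 / (n + 1)\<close> of its distance
  to the value at the new point.\<close>
lemma wdist_empirical_step:
  assumes "n > 0"
  shows "wdist (empirical f n x) (empirical f (Suc n) (x::'a)) \<le> diameter (UNIV :: 'a set) / real (Suc n)"
proof (rule wdist_leI)
  fix \<phi> :: "'a \<Rightarrow> real" assume \<phi>: "1-lipschitz_on UNIV \<phi>"
  define E where "E = (\<integral>y. \<phi> y \<partial>empirical f n x)"
  have E: "(\<Sum>k<n. \<phi> ((f ^^ k) x)) = real n * E"
    using integral_empirical[OF assms lipschitz1_borel[OF \<phi>], of f x] assms by (simp add: E_def)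
  have "(\<integral>y. \<phi> y \<partial>empirical f (Suc n) x) = (real n * E + \<phi> ((f ^^ n) x)) / real (Suc n)"
    using integral_empirical[OF _ lipschitz1_borel[OF \<phi>], of "Suc n" f x] E by simp
  then have "E - (\<integral>y. \<phi> y \<partial>empirical f (Suc n) x) = (E - \<phi> ((f ^^ n) x)) / real (Suc n)"
    by (simp add: field_simps)
  also have "\<dots> \<le> diameter (UNIV :: 'a set) / real (Suc n)"
    using integral_lipschitz_bounds[OF empirical_in_prob_measures[OF assms] \<phi>, of f x "(f ^^ n) x"]
    by (intro divide_right_mono) (auto simp: E_def)
  finally show "(\<integral>y. \<phi> y \<partial>empirical f n x) - (\<integral>y. \<phi> y \<partial>empirical f (Suc n) x) \<le> diameter (UNIV :: 'a set) / real (Suc n)"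
    by (simp add: E_def)
qed

section \<open>Measurability of the distance to the empirical measures\<close>

text \<open>A dense sequence, stated in the uniform form that compactness gives: finitely many terms suffice for
  each precision.\<close>
lemma dense_sequence:
  obtains d :: "nat \<Rightarrow> 'a" where "\<And>\<epsilon>. \<epsilon> > 0 \<Longrightarrow> \<exists>M. \<forall>x. \<exists>i<M. dist (d i) x < \<epsilon>"
proof -
  have "\<exists>F. finite F \<and> (UNIV :: 'a set) \<subseteq> (\<Union>x\<in>F. ball x (1 / real (Suc n)))" for n
    using seq_compact_imp_totally_bounded[of "UNIV :: 'a set"] compact_UNIV
    by (force simp: compact_eq_seq_compact_metric)
  then obtain F where F: "\<And>n. finite (F n)" "\<And>n. (UNIV :: 'a set) \<subseteq> (\<Union>x\<in>F n. ball x (1 / real (Suc n)))"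
    by metis
  define D where "D = (\<Union>n. F n)"
  have "countable D" unfolding D_def using F(1) by (auto intro: countable_finite)
  moreover have "D \<noteq> {}" using F(2) by (fastforce simp: D_def)
  ultimately have range: "range (from_nat_into D) = D" by (rule range_from_nat_into[rotated])
  have "\<exists>M. \<forall>x. \<exists>i<M. dist (from_nat_into D i) x < \<epsilon>" if "\<epsilon> > 0" for \<epsilon>
  proof -
    have "(UNIV :: 'a set) \<subseteq> (\<Union>i. ball (from_nat_into D i) \<epsilon>)"
    proof
      fix x :: 'a
      obtain n where n: "1 / real (Suc n) < \<epsilon>"
        using nat_approx_posE[OF \<open>\<epsilon> > 0\<close>] by metis
      obtain y where "y \<in> F n" "dist y x < 1 / real (Suc n)"
        using subsetD[OF F(2)[of n], of x] by (auto simp del: of_nat_Suc)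
      moreover obtain i where "from_nat_into D i = y"
        using range \<open>y \<in> F n\<close> unfolding D_def by (metis UNIV_I UN_I imageE)
      ultimately show "x \<in> (\<Union>i. ball (from_nat_into D i) \<epsilon>)"
        using n by (auto intro!: exI[of _ i])
    qed
    then obtain I where "finite I" and I: "(UNIV :: 'a set) \<subseteq> (\<Union>i\<in>I. ball (from_nat_into D i) \<epsilon>)"
      using compactE_image[OF compact_UNIV, of UNIV "\<lambda>i. ball (from_nat_into D i) \<epsilon>"] by auto
    have "\<exists>i<Suc (Max I). dist (from_nat_into D i) x < \<epsilon>" for x
    proof -
      obtain i where "i \<in> I" "dist (from_nat_into D i) x < \<epsilon>"
        using subsetD[OF I UNIV_I, of x] by auto
      then show ?thesis
        using Max_ge[OF \<open>finite I\<close>] by (auto simp: less_Suc_eq_le)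
    qed
    then show ?thesis by blast
  qed
  then show thesis by (rule that)
qed

text \<open>By McShane's formula a 1-Lipschitz function is the infimum of the cones \<open>\<phi> a + dist a x\<close>. Using only
  finitely many apexes \<open>a\<close> from the dense sequence, with rational heights, leaves countably many functions,
  which are still 1-Lipschitz and approximate all of them uniformly.\<close>
lemma countable_dense_lipschitz:
  obtains \<Phi> :: "('a \<Rightarrow> real) set" where "countable \<Phi>" "\<Phi> \<noteq> {}" "\<And>\<psi>. \<psi> \<in> \<Phi> \<Longrightarrow> 1-lipschitz_on UNIV \<psi>"
    "\<And>\<phi> \<epsilon>. 1-lipschitz_on UNIV \<phi> \<Longrightarrow> \<epsilon> > 0 \<Longrightarrow> \<exists>\<psi>\<in>\<Phi>. \<forall>x. \<bar>\<phi> x - \<psi> x\<bar> \<le> \<epsilon>"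
proof -
  obtain d :: "nat \<Rightarrow> 'a" where d: "\<And>\<epsilon>. \<epsilon> > 0 \<Longrightarrow> \<exists>M. \<forall>x. \<exists>i<M. dist (d i) x < \<epsilon>"
    using dense_sequence by blast
  define \<psi> where "\<psi> q x = (MIN i\<in>{..<length q}. of_rat (q ! i) + dist (d i) x)" for q :: "rat list" and x
  have \<psi>_le: "\<psi> q x \<le> of_rat (q ! i) + dist (d i) x" if "i < length q" for q x i
    unfolding \<psi>_def using that by (intro Min_le) auto
  have \<psi>_eq: "\<exists>i<length q. \<psi> q x = of_rat (q ! i) + dist (d i) x" if "q \<noteq> []" for q x
  proof -
    have "\<psi> q x \<in> (\<lambda>i. of_rat (q ! i) + dist (d i) x) ` {..<length q}"
      unfolding \<psi>_def using that by (intro Min_in) auto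
    then show ?thesis by auto
  qed
  show thesis
  proof (rule that[of "\<psi> ` {q. q \<noteq> []}"])
    fix \<theta> assume "\<theta> \<in> \<psi> ` {q. q \<noteq> []}"
    then obtain q where q: "q \<noteq> []" "\<theta> = \<psi> q" by auto
    have "\<psi> q x \<le> \<psi> q y + dist x y" for x y
    proof -
      obtain i where "i < length q" "\<psi> q y = of_rat (q ! i) + dist (d i) y"
        using \<psi>_eq[OF q(1)] by blast
      then show ?thesis
        using \<psi>_le[of i q x] dist_triangle[of "d i" x y] by (simp add: dist_commute)
    qed
    then show "1-lipschitz_on UNIV \<theta>"
      unfolding q(2) lipschitz1_iff by (metis abs_le_iff diff_le_eq add.commute dist_commute minus_diff_eq)
  next
    fix \<phi> :: "'a \<Rightarrow> real" and \<epsilon> :: real assume \<phi>: "1-lipschitz_on UNIV \<phi>" and "\<epsilon> > 0"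
    have lip: "\<phi> x \<le> \<phi> y + dist y x" for x y
      using \<phi> unfolding lipschitz1_iff by (metis abs_le_D1 diff_le_eq dist_commute add.commute)
    obtain M where M: "\<And>x. \<exists>i<M. dist (d i) x < \<epsilon> / 3"
      using d[of "\<epsilon> / 3"] \<open>\<epsilon> > 0\<close> by auto
    have "\<exists>r. \<phi> (d i) < of_rat r \<and> of_rat r < \<phi> (d i) + \<epsilon> / 3" for i
      using of_rat_dense[of "\<phi> (d i)" "\<phi> (d i) + \<epsilon> / 3"] \<open>\<epsilon> > 0\<close> by auto
    then obtain r where r: "\<And>i. \<phi> (d i) < of_rat (r i)" "\<And>i. of_rat (r i) < \<phi> (d i) + \<epsilon> / 3"
      by metis
    define q where "q = map r [0..<M]"
    have len: "length q = M" and nth: "\<And>i. i < M \<Longrightarrow> q ! i = r i"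
      by (auto simp: q_def)
    have ne: "q \<noteq> []" using M[of undefined] len by auto
    \<comment> \<open>The heights lie slightly above \<open>\<phi>\<close>, so every cone lies above \<open>\<phi>\<close>. At a point within \<open>\<epsilon> / 3\<close> of an apex
      the excess is at most \<open>\<epsilon> / 3\<close> for the height and twice \<open>\<epsilon> / 3\<close> for moving to the apex and back.\<close>
    have "\<bar>\<phi> x - \<psi> q x\<bar> \<le> \<epsilon>" for x
    proof -
      obtain i where i: "i < M" "\<psi> q x = of_rat (r i) + dist (d i) x"
        using \<psi>_eq[OF ne, of x] len nth by auto
      then have "\<phi> x \<le> \<psi> q x"
        using lip[of x "d i"] r(1)[of i] by simp
      moreover obtain j where j: "j < M" "dist (d j) x < \<epsilon> / 3"
        using M by blast
      then have "\<psi> q x \<le> \<phi> x + \<epsilon>"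
        using \<psi>_le[of j q x] len nth[of j] lip[of "d j" x] r(2)[of j] by (simp add: dist_commute)
      ultimately show ?thesis by simp
    qed
    then show "\<exists>\<theta>\<in>\<psi> ` {q. q \<noteq> []}. \<forall>x. \<bar>\<phi> x - \<theta> x\<bar> \<le> \<epsilon>"
      using ne by blast
  qed (auto intro: exI[of _ "[0]"])
qed

text \<open>The supremum that defines the distance is unchanged when it is taken over a countable uniformly dense
  set of Lipschitz functions, and each single difference of integrals is a finite sum of measurable
  functions of \<open>x\<close>.\<close>
lemma wdist_empirical_measurable:
  assumes f: "f \<in> borel \<rightarrow>\<^sub>M borel" and \<nu>: "\<nu> \<in> prob_measures"
  shows "(\<lambda>x::'a. wdist (empirical f n x) \<nu>) \<in> borel_measurable borel"
proof (cases "n = 0")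
  case True
  \<comment> \<open>The zero measure is the same for every starting point, so the function is constant.\<close>
  then show ?thesis by (simp add: empirical_def)
next
  case False
  then have n: "n > 0" by simp
  obtain \<Phi> :: "('a \<Rightarrow> real) set" where \<Phi>: "countable \<Phi>" "\<Phi> \<noteq> {}" "\<And>\<psi>. \<psi> \<in> \<Phi> \<Longrightarrow> 1-lipschitz_on UNIV \<psi>"
    "\<And>\<phi> \<epsilon>. 1-lipschitz_on UNIV \<phi> \<Longrightarrow> \<epsilon> > 0 \<Longrightarrow> \<exists>\<psi>\<in>\<Phi>. \<forall>x. \<bar>\<phi> x - \<psi> x\<bar> \<le> \<epsilon>"
    using countable_dense_lipschitz by blast
  define \<Delta> where "\<Delta> x \<phi> = (\<Sum>k<n. \<phi> ((f ^^ k) x)) / real n - (\<integral>y. \<phi> y \<partial>\<nu>)" for x and \<phi> :: "'a \<Rightarrow> real"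
  note e = empirical_in_prob_measures[OF n]
  have \<Delta>: "\<Delta> x \<phi> = (\<integral>y. \<phi> y \<partial>empirical f n x) - (\<integral>y. \<phi> y \<partial>\<nu>)" if "1-lipschitz_on UNIV \<phi>" for x \<phi>
    unfolding \<Delta>_def using integral_empirical[OF n lipschitz1_borel[OF that]] by simp
  have \<Delta>_le: "\<Delta> x \<phi> \<le> wdist (empirical f n x) \<nu>" if "\<phi> \<in> \<Phi>" for x \<phi>
    using integral_diff_le_wdist[OF e \<nu> \<Phi>(3)[OF that]] \<Delta>[OF \<Phi>(3)[OF that]] by simp
  have bdd: "bdd_above (\<Delta> x ` \<Phi>)" for x
    using \<Delta>_le by (intro bdd_aboveI2)
  have "wdist (empirical f n x) \<nu> = (SUP \<phi>\<in>\<Phi>. \<Delta> x \<phi>)" for x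
  proof (rule antisym)
    show "wdist (empirical f n x) \<nu> \<le> (SUP \<phi>\<in>\<Phi>. \<Delta> x \<phi>)"
    proof (rule wdist_leI)
      fix \<phi> :: "'a \<Rightarrow> real" assume \<phi>: "1-lipschitz_on UNIV \<phi>"
      have "\<Delta> x \<phi> \<le> (SUP \<phi>\<in>\<Phi>. \<Delta> x \<phi>) + \<epsilon>" if "\<epsilon> > 0" for \<epsilon>
      proof -
        obtain \<psi> where \<psi>: "\<psi> \<in> \<Phi>" "\<And>x. \<bar>\<phi> x - \<psi> x\<bar> \<le> \<epsilon> / 2"
          using \<Phi>(4)[OF \<phi>, of "\<epsilon> / 2"] \<open>\<epsilon> > 0\<close> by auto
        have close: "\<bar>(\<integral>x. \<phi> x \<partial>\<rho>) - (\<integral>x. \<psi> x \<partial>\<rho>)\<bar> \<le> \<epsilon> / 2" if "\<rho> \<in> prob_measures" for \<rho>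
        proof -
          interpret prob_space \<rho> using prob_measuresD[OF that] by simp
          have int: "integrable \<rho> \<phi>" "integrable \<rho> \<psi>"
            using integrable_lipschitz[OF that] \<phi> \<Phi>(3)[OF \<psi>(1)] by auto
          then have "\<bar>\<integral>x. \<phi> x - \<psi> x \<partial>\<rho>\<bar> \<le> (\<integral>x. \<epsilon> / 2 \<partial>\<rho>)"
            using \<psi>(2) by (intro integral_abs_bound[THEN order_trans] integral_mono) auto
          then show ?thesis using int by (simp add: prob_space)
        qed
        have "\<Delta> x \<phi> \<le> \<Delta> x \<psi> + \<epsilon>"
          using close[OF e, of f x] close[OF \<nu>] \<Delta>[OF \<phi>, of x] \<Delta>[OF \<Phi>(3)[OF \<psi>(1)], of x] by linarith
        then show ?thesis using cSUP_upper[OF \<psi>(1) bdd, of x] by linarith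
      qed
      then have "\<Delta> x \<phi> \<le> (SUP \<phi>\<in>\<Phi>. \<Delta> x \<phi>)" by (rule field_le_epsilon)
      then show "(\<integral>y. \<phi> y \<partial>empirical f n x) - (\<integral>y. \<phi> y \<partial>\<nu>) \<le> (SUP \<phi>\<in>\<Phi>. \<Delta> x \<phi>)"
        by (simp add: \<Delta>[OF \<phi>])
    qed
    show "(SUP \<phi>\<in>\<Phi>. \<Delta> x \<phi>) \<le> wdist (empirical f n x) \<nu>"
      using \<Phi>(2) \<Delta>_le by (rule cSUP_least)
  qed
  moreover have "(\<lambda>x. SUP \<phi>\<in>\<Phi>. \<Delta> x \<phi>) \<in> borel_measurable borel"
  proof (rule borel_measurable_cSUP)
    fix \<phi> assume "\<phi> \<in> \<Phi>"
    note [measurable] = lipschitz1_borel[OF \<Phi>(3)[OF this]] f measurable_compose_n[OF f]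
    show "(\<lambda>x. \<Delta> x \<phi>) \<in> borel_measurable borel"
      unfolding \<Delta>_def by measurable
  qed (use \<Phi>(1) bdd in auto)
  ultimately show ?thesis by simp
qed

section \<open>Sequential compactness of the space of probability measures\<close>

text \<open>With a dense sequence the distance becomes a countable supremum of functions in which the two points
  enter separately, so no joint measurability on the product is involved.\<close>
lemma dist_borel_measurable:
  assumes "X \<in> M \<rightarrow>\<^sub>M borel" "Y \<in> M \<rightarrow>\<^sub>M borel"
  shows "(\<lambda>\<omega>. dist (X \<omega>) (Y \<omega> :: 'a)) \<in> borel_measurable M"
proof -
  obtain d :: "nat \<Rightarrow> 'a" where d: "\<And>\<epsilon>. \<epsilon> > 0 \<Longrightarrow> \<exists>M. \<forall>x. \<exists>i<M. dist (d i) x < \<epsilon>"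
    using dense_sequence by blast
  have le: "\<bar>dist (d i) x - dist (d i) y\<bar> \<le> dist x y" for i x y
    using abs_dist_diff_le[of "d i" x y] by (metis dist_commute abs_dist_diff_le)
  then have bdd: "bdd_above (range (\<lambda>i. \<bar>dist (d i) x - dist (d i) y\<bar>))" for x y
    by (intro bdd_aboveI2)
  have eq: "dist x y = (SUP i. \<bar>dist (d i) x - dist (d i) y\<bar>)" for x y
  proof (rule antisym)
    show "(SUP i. \<bar>dist (d i) x - dist (d i) y\<bar>) \<le> dist x y"
      using le by (intro cSUP_least) auto
    show "dist x y \<le> (SUP i. \<bar>dist (d i) x - dist (d i) y\<bar>)"
    proof (rule field_le_epsilon)
      fix \<epsilon> :: real assume "\<epsilon> > 0"
      then obtain i where "dist (d i) x < \<epsilon> / 2" using d[of "\<epsilon> / 2"] by auto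
      then have "dist x y \<le> \<bar>dist (d i) x - dist (d i) y\<bar> + \<epsilon>"
        using dist_triangle[of x y "d i"] by (simp add: dist_commute)
      then show "dist x y \<le> (SUP i. \<bar>dist (d i) x - dist (d i) y\<bar>) + \<epsilon>"
        using cSUP_upper[OF UNIV_I bdd[of x y], of i] by linarith
    qed
  qed
  have [measurable]: "(\<lambda>\<omega>. dist (d i) (X \<omega>)) \<in> borel_measurable M" "(\<lambda>\<omega>. dist (d i) (Y \<omega>)) \<in> borel_measurable M" for i
    by (auto intro!: measurable_compose[OF assms(1)] measurable_compose[OF assms(2)] borel_measurable_continuous_onI continuous_intros)
  have "(\<lambda>\<omega>. SUP i. \<bar>dist (d i) (X \<omega>) - dist (d i) (Y \<omega>)\<bar>) \<in> borel_measurable M"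
    by (rule borel_measurable_cSUP) (use bdd in auto)
  then show ?thesis by (subst eq)
qed

text \<open>The digit of \<open>s x\<close> at place \<open>n\<close> tells whether \<open>x\<close> lies in the ball number \<open>n\<close>, where the balls have
  centres in a dense sequence and radii \<open>1 / (k + 1)\<close>. By compactness finitely many balls of radius
  \<open>1 / (k + 1)\<close> cover the space. Points whose codes are close share the digits of these balls, hence lie
  in a common one.\<close>
lemma real_coding:
  obtains s :: "'a \<Rightarrow> real" where "s \<in> borel_measurable borel" "\<And>x. 0 \<le> s x" "\<And>x. s x \<le> 2"
    "\<And>\<epsilon>. \<epsilon> > 0 \<Longrightarrow> \<exists>\<delta>>0. \<forall>x y. \<bar>s x - s y\<bar> < \<delta> \<longrightarrow> dist x y < \<epsilon>"
proof -
  obtain d :: "nat \<Rightarrow> 'a" where d: "\<And>\<epsilon>. \<epsilon> > 0 \<Longrightarrow> \<exists>M. \<forall>x. \<exists>i<M. dist (d i) x < \<epsilon>"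
    using dense_sequence by blast
  define U where "U n = (case prod_decode n of (i, k) \<Rightarrow> ball (d i) (1 / real (Suc k)))" for n
  define s where "s x = (\<Sum>n. indicator (U n) x / 3 ^ n :: real)" for x
  have [measurable]: "U n \<in> sets borel" for n
    by (auto simp: U_def split: prod.split)
  have summable: "summable (\<lambda>n. indicator (U n) x / 3 ^ n :: real)" for x
    by (rule summable_bounded_digits) (auto simp: indicator_def)
  show thesis
  proof (rule that[of s])
    show "s \<in> borel_measurable borel"
      unfolding s_def by measurable
    show "0 \<le> s x" for x
      unfolding s_def using summable by (intro suminf_nonneg) auto
    have "s x \<le> (\<Sum>n. (1 / 3) ^ n)" for x
      unfolding s_def using summable summable_bounded_digits[of "\<lambda>_. 1"]
      by (intro suminf_le) (auto simp: indicator_def power_divide)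
    then show "s x \<le> 2" for x
      by (rule order_trans) (simp add: suminf_geometric)
    fix \<epsilon> :: real assume "\<epsilon> > 0"
    then obtain k where k: "1 / real (Suc k) < \<epsilon> / 2"
      using nat_approx_posE[of "\<epsilon> / 2"] by auto
    obtain M where M: "\<And>x. \<exists>i<M. dist (d i) x < 1 / real (Suc k)"
      using d[of "1 / real (Suc k)"] by auto
    define K where "K = Max ((\<lambda>i. prod_encode (i, k)) ` {..<M})"
    have "dist x y < \<epsilon>" if close: "\<bar>s x - s y\<bar> < 1 / (2 * 3 ^ K)" for x y
    proof -
      obtain i where i: "i < M" "dist (d i) x < 1 / real (Suc k)" using M by blast
      have "prod_encode (i, k) \<le> K"
        unfolding K_def using i by (intro Max_ge) auto
      with close have "indicator (U (prod_encode (i, k))) x = (indicator (U (prod_encode (i, k))) y :: real)"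
        unfolding s_def by (intro ternary_digits_eq[where K = K]) (auto simp: indicator_def)
      then have "dist (d i) y < 1 / real (Suc k)"
        using i by (simp add: U_def indicator_def split: if_splits)
      then show ?thesis
        using i k dist_triangle[of x y "d i"] by (simp add: dist_commute)
    qed
    then show "\<exists>\<delta>>0. \<forall>x y. \<bar>s x - s y\<bar> < \<delta> \<longrightarrow> dist x y < \<epsilon>"
      by (intro exI[of _ "1 / (2 * 3 ^ K)"]) auto
  qed
qed

text \<open>The measures are transported to the real line by the coding, where Helly's and Skorohod's theorems give
  an almost surely convergent coupling, which is then decoded. A limit of codes
  need not be a code, so the decoded points cannot be passed to the limit by continuity; but the uniformly
  continuous decoding keeps them Cauchy, and the space is complete.\<close>
theorem prob_measures_seq_compact:
  fixes \<mu> :: "nat \<Rightarrow> 'a measure"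
  assumes \<mu>: "\<And>n. \<mu> n \<in> prob_measures"
  shows "\<exists>r \<nu>. strict_mono r \<and> \<nu> \<in> prob_measures \<and> (\<lambda>n. wdist (\<mu> (r n)) \<nu>) \<longlonglongrightarrow> 0"
proof -
  obtain d :: "nat \<Rightarrow> 'a" where d: "\<And>\<epsilon>. \<epsilon> > 0 \<Longrightarrow> \<exists>M. \<forall>x. \<exists>i<M. dist (d i) x < \<epsilon>"
    using dense_sequence by blast
  obtain s :: "'a \<Rightarrow> real" where s: "s \<in> borel_measurable borel" "\<And>x. 0 \<le> s x" "\<And>x. s x \<le> 2"
    and s_unif: "\<And>\<epsilon>. \<epsilon> > 0 \<Longrightarrow> \<exists>\<delta>>0. \<forall>x y. \<bar>s x - s y\<bar> < \<delta> \<longrightarrow> dist x y < \<epsilon>"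
    using real_coding by metis
  have s_inj: "x = y" if "s x = s y" for x y
  proof (rule ccontr)
    assume "x \<noteq> y"
    then show False using s_unif[of "dist x y"] that by force
  qed
  \<comment> \<open>Rounding to a dense sequence: the rounded measures live on a countable set, on which every function
    is Borel, so the decoding \<open>g\<close> below is measurable although the range of \<open>s\<close> may not be a Borel set.\<close>
  define \<pi> where "\<pi> n x = d (LEAST i. dist (d i) x < 1 / real (Suc n))" for n x
  have \<pi>_range: "\<pi> n x \<in> range d" for n x by (simp add: \<pi>_def)
  have \<pi>_close: "dist (\<pi> n x) x < 1 / real (Suc n)" for n x
  proof -
    have "\<exists>i. dist (d i) x < 1 / real (Suc n)"
      using d[of "1 / real (Suc n)"] by auto
    then show ?thesis unfolding \<pi>_def by (rule LeastI_ex)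
  qed
  have \<pi>_meas[measurable]: "\<pi> n \<in> borel \<rightarrow>\<^sub>M borel" for n
  proof -
    have [measurable]: "dist (d i) \<in> borel_measurable borel" for i
      by (intro borel_measurable_continuous_onI continuous_intros)
    have "(\<lambda>x. dist (d i) x < 1 / real (Suc n)) \<in> borel \<rightarrow>\<^sub>M count_space UNIV" for i
      by measurable
    then have "(\<lambda>x. LEAST i. dist (d i) x < 1 / real (Suc n)) \<in> borel \<rightarrow>\<^sub>M count_space UNIV"
      by (rule measurable_Least)
    then show ?thesis
      unfolding \<pi>_def by (rule measurable_compose) simp
  qed
  define g where "g c = (if c \<in> s ` range d then the_inv s c else d 0)" for c
  have g: "g (s x) = x" if "x \<in> range d" for x
    using that s_inj by (auto simp: g_def intro!: the_inv_f_f injI)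
  have cnt: "countable (s ` range d)" by simp
  have cnt_sets[measurable]: "s ` range d \<in> sets borel"
    by (rule sets.countable[OF _ cnt]) simp
  have g_meas[measurable]: "g \<in> borel \<rightarrow>\<^sub>M borel"
    by (rule measurable_discrete_difference[of "\<lambda>_. d 0" _ _ "s ` range d"])
      (use cnt in \<open>auto simp: g_def\<close>)
  note s(1)[measurable]
  have \<mu>_sets[measurable_cong]: "sets (\<mu> n) = sets borel" for n
    using prob_measuresD[OF \<mu>] by simp
  define \<kappa> where "\<kappa> n = distr (\<mu> n) borel (\<lambda>x. s (\<pi> n x))" for n
  have \<kappa>_real: "real_distribution (\<kappa> n)" for n
  proof -
    interpret prob_space "\<mu> n" using prob_measuresD[OF \<mu>] by simp
    show ?thesis unfolding \<kappa>_def by (rule real_distribution_distr) simp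
  qed
  have "tight \<kappa>"
    unfolding tight_def
  proof (intro conjI allI impI \<kappa>_real)
    fix \<epsilon> :: real assume "\<epsilon> > 0"
    have "measure (\<kappa> n) {-1<..2} > 1 - \<epsilon>" for n
    proof -
      interpret prob_space "\<mu> n" using prob_measuresD[OF \<mu>] by simp
      have "(\<lambda>x. s (\<pi> n x)) -` {-1<..2} = UNIV"
        using s(3) less_le_trans[OF _ s(2), of "-1"] by auto
      then have "measure (\<kappa> n) {-1<..2} = 1"
        using prob_space prob_measuresD(3)[OF \<mu>] by (simp add: \<kappa>_def measure_distr)
      then show ?thesis using \<open>\<epsilon> > 0\<close> by simp
    qed
    then show "\<exists>a b. a < b \<and> (\<forall>n. measure (\<kappa> n) {a<..b} > 1 - \<epsilon>)"
      by (intro exI[of _ "-1"] exI[of _ 2]) simp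
  qed
  then obtain r M where r: "strict_mono r" "real_distribution M" "weak_conv_m (\<kappa> \<circ> r) M"
    using tight_imp_convergent_subsubsequence[of \<kappa> id] by (auto simp: strict_mono_id)
  obtain \<Omega> :: "real measure" and Y Y' where \<Omega>: "prob_space \<Omega>" "\<And>n. Y n \<in> \<Omega> \<rightarrow>\<^sub>M borel"
    "\<And>n. distr \<Omega> borel (Y n) = \<kappa> (r n)" "\<And>\<omega>. \<omega> \<in> space \<Omega> \<Longrightarrow> (\<lambda>n. Y n \<omega>) \<longlonglongrightarrow> Y' \<omega>"
    using Skorohod[of "\<kappa> \<circ> r" M] \<kappa>_real r(2,3) unfolding comp_def by metis
  interpret \<Omega>: prob_space \<Omega> by fact
  note \<Omega>(2)[measurable]
  \<comment> \<open>The outcomes at which every \<open>Y n\<close> is the code of a point of the dense sequence.\<close>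
  define G where "G = {\<omega> \<in> space \<Omega>. \<forall>n. Y n \<omega> \<in> s ` range d}"
  have G_sets[measurable]: "G \<in> sets \<Omega>"
    unfolding G_def by measurable
  have AE_G: "AE \<omega> in \<Omega>. \<omega> \<in> G"
  proof -
    have "AE \<omega> in \<Omega>. Y n \<omega> \<in> s ` range d" for n
    proof -
      have "AE c in \<kappa> (r n). c \<in> s ` range d"
        unfolding \<kappa>_def by (subst AE_distr_iff) (use \<pi>_range in auto)
      then show ?thesis
        unfolding \<Omega>(3)[symmetric] by (subst (asm) AE_distr_iff) auto
    qed
    then have "AE \<omega> in \<Omega>. \<forall>n. Y n \<omega> \<in> s ` range d" by (simp add: AE_all_countable)
    then show ?thesis by (auto simp: G_def)
  qed
  define X where "X n \<omega> = (if \<omega> \<in> G then g (Y n \<omega>) else d 0)" for n \<omega>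
  have X_meas[measurable]: "X n \<in> \<Omega> \<rightarrow>\<^sub>M borel" for n
    unfolding X_def by measurable
  have "convergent (\<lambda>n. X n \<omega>)" if "\<omega> \<in> space \<Omega>" for \<omega>
  proof (cases "\<omega> \<in> G")
    case True
    have sX: "s (X n \<omega>) = Y n \<omega>" for n
    proof -
      obtain i where "Y n \<omega> = s (d i)" using True by (auto simp: G_def)
      then show ?thesis using True g[of "d i"] by (simp add: X_def)
    qed
    have "Cauchy (\<lambda>n. Y n \<omega>)"
      using \<Omega>(4)[OF that] by (rule LIMSEQ_imp_Cauchy)
    have "Cauchy (\<lambda>n. X n \<omega>)"
    proof (rule metric_CauchyI)
      fix \<epsilon> :: real assume "\<epsilon> > 0"
      then obtain \<delta> where \<delta>: "\<delta> > 0" "\<And>x y. \<bar>s x - s y\<bar> < \<delta> \<Longrightarrow> dist x y < \<epsilon>"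
        using s_unif by blast
      obtain K where "\<And>m n. m \<ge> K \<Longrightarrow> n \<ge> K \<Longrightarrow> dist (Y m \<omega>) (Y n \<omega>) < \<delta>"
        using metric_CauchyD[OF \<open>Cauchy (\<lambda>n. Y n \<omega>)\<close> \<delta>(1)] by blast
      then show "\<exists>K. \<forall>m\<ge>K. \<forall>n\<ge>K. dist (X m \<omega>) (X n \<omega>) < \<epsilon>"
        using \<delta>(2) sX by (intro exI[of _ K]) (auto simp: dist_real_def)
    qed
    then show ?thesis
      using completeE[OF compact_imp_complete[OF compact_UNIV]] by (metis UNIV_I convergentI)
  qed (simp add: X_def convergent_const)
  then have lim: "(\<lambda>n. X n \<omega>) \<longlonglongrightarrow> lim (\<lambda>n. X n \<omega>)" if "\<omega> \<in> space \<Omega>" for \<omega>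
    using that by (simp add: convergent_LIMSEQ_iff)
  define Z where "Z \<omega> = lim (\<lambda>n. X n \<omega>)" for \<omega>
  have Z_meas[measurable]: "Z \<in> \<Omega> \<rightarrow>\<^sub>M borel"
    using X_meas lim unfolding Z_def by (rule borel_measurable_LIMSEQ_metric)
  have dist_meas[measurable]: "(\<lambda>\<omega>. dist (X n \<omega>) (Z \<omega>)) \<in> borel_measurable \<Omega>" for n
    using X_meas Z_meas by (rule dist_borel_measurable)
  have "(\<lambda>n. \<integral>\<omega>. dist (X n \<omega>) (Z \<omega>) \<partial>\<Omega>) \<longlonglongrightarrow> (\<integral>\<omega>. 0 \<partial>\<Omega>)"
  proof (rule integral_dominated_convergence[where w = "\<lambda>_. diameter (UNIV :: 'a set)"])
    show "AE \<omega> in \<Omega>. (\<lambda>n. dist (X n \<omega>) (Z \<omega>)) \<longlonglongrightarrow> 0"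
      using lim by (auto simp: Z_def tendsto_dist_iff[symmetric])
  qed (auto simp: dist_le_diam)
  then have bound_lim: "(\<lambda>n. 1 / real (Suc n) + (\<integral>\<omega>. dist (X n \<omega>) (Z \<omega>) \<partial>\<Omega>)) \<longlonglongrightarrow> 0 + 0"
    by (intro tendsto_add LIMSEQ_Suc[OF lim_1_over_n]) simp
  define \<nu> where "\<nu> = distr \<Omega> borel Z"
  have \<nu>: "\<nu> \<in> prob_measures"
    unfolding \<nu>_def space_prob_algebra using \<Omega>.prob_space_distr[OF Z_meas] by simp
  have X_law: "distr \<Omega> borel (X n) \<in> prob_measures" for n
    unfolding space_prob_algebra using \<Omega>.prob_space_distr[OF X_meas] by simp
  have bound: "wdist (\<mu> (r n)) \<nu> \<le> 1 / real (Suc n) + (\<integral>\<omega>. dist (X n \<omega>) (Z \<omega>) \<partial>\<Omega>)" for n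
  proof (rule wdist_leI)
    fix \<phi> :: "'a \<Rightarrow> real" assume \<phi>: "1-lipschitz_on UNIV \<phi>"
    note lip = \<phi>[unfolded lipschitz1_iff, rule_format]
    note [measurable] = lipschitz1_borel[OF \<phi>]
    interpret \<mu>: prob_space "\<mu> (r n)" using prob_measuresD[OF \<mu>] by simp
    have int_X: "integrable \<Omega> (\<lambda>\<omega>. \<phi> (X n \<omega>))"
      using integrable_lipschitz[OF X_law \<phi>] by (simp add: integrable_distr_eq)
    have int_Z: "integrable \<Omega> (\<lambda>\<omega>. \<phi> (Z \<omega>))"
      using integrable_lipschitz[OF \<nu> \<phi>] by (simp add: \<nu>_def integrable_distr_eq)
    have int_\<mu>: "integrable (\<mu> (r n)) \<phi>"
      by (rule integrable_lipschitz[OF \<mu> \<phi>])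
    have \<phi>_le: "\<bar>\<phi> x\<bar> \<le> \<bar>\<phi> undefined\<bar> + diameter (UNIV :: 'a set)" for x
      using lipschitz_osc_le_diameter[OF \<phi>, of x undefined] by simp
    have int_\<pi>: "integrable (\<mu> (r n)) (\<lambda>x. \<phi> (\<pi> (r n) x))"
      by (rule \<mu>.integrable_const_bound[where B = "\<bar>\<phi> undefined\<bar> + diameter (UNIV :: 'a set)"])
        (use \<phi>_le in auto)
    have int_dist: "integrable \<Omega> (\<lambda>\<omega>. dist (X n \<omega>) (Z \<omega>))"
      by (rule \<Omega>.integrable_const_bound[where B = "diameter (UNIV :: 'a set)"])
        (auto simp: dist_le_diam)
    \<comment> \<open>\<open>X n\<close> has the law of the rounded measure.\<close>
    have "(\<integral>x. \<phi> (\<pi> (r n) x) \<partial>\<mu> (r n)) = (\<integral>c. \<phi> (g c) \<partial>\<kappa> (r n))"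
      unfolding \<kappa>_def by (subst integral_distr) (auto simp: g[OF \<pi>_range])
    also have "\<dots> = (\<integral>\<omega>. \<phi> (g (Y n \<omega>)) \<partial>\<Omega>)"
      unfolding \<Omega>(3)[symmetric] by (subst integral_distr) auto
    also have "\<dots> = (\<integral>\<omega>. \<phi> (X n \<omega>) \<partial>\<Omega>)"
      using AE_G by (intro integral_cong_AE) (auto simp: X_def)
    finally have eq: "(\<integral>x. \<phi> (\<pi> (r n) x) \<partial>\<mu> (r n)) = (\<integral>\<omega>. \<phi> (X n \<omega>) \<partial>\<Omega>)" .
    have "(\<integral>x. \<phi> x - \<phi> (\<pi> (r n) x) \<partial>\<mu> (r n)) \<le> (\<integral>x. 1 / real (Suc n) \<partial>\<mu> (r n))"
    proof (rule integral_mono)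
      fix x
      have "n \<le> r n" using r(1) by (rule strict_mono_imp_increasing)
      then have "1 / real (Suc (r n)) \<le> 1 / real (Suc n)" by (simp add: frac_le)
      then show "\<phi> x - \<phi> (\<pi> (r n) x) \<le> 1 / real (Suc n)"
        using lip[of x "\<pi> (r n) x"] \<pi>_close[of "r n" x] by (simp add: dist_commute abs_le_iff)
    qed (use int_\<mu> int_\<pi> in auto)
    then have 1: "(\<integral>x. \<phi> x \<partial>\<mu> (r n)) - (\<integral>\<omega>. \<phi> (X n \<omega>) \<partial>\<Omega>) \<le> 1 / real (Suc n)"
      using int_\<mu> int_\<pi> by (simp add: eq \<mu>.prob_space)
    have "(\<integral>\<omega>. \<phi> (X n \<omega>) - \<phi> (Z \<omega>) \<partial>\<Omega>) \<le> (\<integral>\<omega>. dist (X n \<omega>) (Z \<omega>) \<partial>\<Omega>)"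
      using int_X int_Z int_dist lip by (intro integral_mono) (auto simp: abs_le_iff)
    then have 2: "(\<integral>\<omega>. \<phi> (X n \<omega>) \<partial>\<Omega>) - (\<integral>\<omega>. \<phi> (Z \<omega>) \<partial>\<Omega>) \<le> (\<integral>\<omega>. dist (X n \<omega>) (Z \<omega>) \<partial>\<Omega>)"
      using int_X int_Z by simp
    have "(\<integral>x. \<phi> x \<partial>\<nu>) = (\<integral>\<omega>. \<phi> (Z \<omega>) \<partial>\<Omega>)"
      unfolding \<nu>_def by (rule integral_distr) auto
    with 1 2 show "(\<integral>x. \<phi> x \<partial>\<mu> (r n)) - (\<integral>x. \<phi> x \<partial>\<nu>)
      \<le> 1 / real (Suc n) + (\<integral>\<omega>. dist (X n \<omega>) (Z \<omega>) \<partial>\<Omega>)" by linarith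
  qed
  have "(\<lambda>n. wdist (\<mu> (r n)) \<nu>) \<longlonglongrightarrow> 0"
  proof (rule tendsto_sandwich[OF _ _ tendsto_const])
    show "(\<lambda>n. 1 / real (Suc n) + (\<integral>\<omega>. dist (X n \<omega>) (Z \<omega>) \<partial>\<Omega>)) \<longlonglongrightarrow> 0"
      using bound_lim by simp
  qed (intro always_eventually allI wdist_nonneg[OF \<mu> \<nu>] bound)+
  then show ?thesis using r(1) \<nu> by blast
qed

text \<open>One subsequence for finitely many sequences of measures, extracted one sequence at a time.\<close>
corollary prob_measures_seq_compact_family:
  fixes \<mu> :: "nat \<Rightarrow> nat \<Rightarrow> 'a measure"
  assumes \<mu>: "\<And>j n. j < N \<Longrightarrow> \<mu> j n \<in> prob_measures"
  shows "\<exists>r \<nu>. strict_mono r \<and> (\<forall>j<N. \<nu> j \<in> prob_measures \<and> (\<lambda>n. wdist (\<mu> j (r n)) (\<nu> j)) \<longlonglongrightarrow> 0)"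
  using \<mu>
proof (induction N)
  case 0
  then show ?case using strict_mono_id by blast
next
  case (Suc N)
  then obtain r \<nu> where r: "strict_mono r"
    and \<nu>: "\<And>j. j < N \<Longrightarrow> \<nu> j \<in> prob_measures \<and> (\<lambda>n. wdist (\<mu> j (r n)) (\<nu> j)) \<longlonglongrightarrow> 0"
    by (metis less_SucI)
  obtain r' \<nu>' where r': "strict_mono r'" "\<nu>' \<in> prob_measures" "(\<lambda>n. wdist (\<mu> N (r (r' n))) \<nu>') \<longlonglongrightarrow> 0"
    using prob_measures_seq_compact[of "\<lambda>n. \<mu> N (r n)"] Suc.prems by blast
  have "(\<lambda>n. wdist (\<mu> j (r (r' n))) (\<nu> j)) \<longlonglongrightarrow> 0" if "j < N" for j
    using LIMSEQ_subseq_LIMSEQ[OF conjunct2[OF \<nu>[OF that]] r'(1)] by (simp add: o_def)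
  then show ?case
    using strict_mono_o[OF r r'(1)] \<nu> r'(2,3)
    by (intro exI[of _ "\<lambda>n. r (r' n)"] exI[of _ "\<nu>(N := \<nu>')"]) (auto simp: less_Suc_eq o_def)
qed

section \<open>Vanishing limit distance and basins\<close>

lemma limit_dist_measurable:
  assumes f: "f \<in> borel \<rightarrow>\<^sub>M borel" and \<nu>: "\<And>j. j < N \<Longrightarrow> \<nu> j \<in> prob_measures"
  shows "limit_dist f N \<nu> \<in> (borel :: 'a measure) \<rightarrow>\<^sub>M borel"
proof -
  have "(\<lambda>x. INF j\<in>{..<N}. ennreal (wdist (empirical f n x) (\<nu> j))) \<in> (borel :: 'a measure) \<rightarrow>\<^sub>M borel" for n
    using wdist_empirical_measurable[OF f] \<nu>
    by (intro borel_measurable_INF measurable_compose[OF _ measurable_ennreal]) auto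
  then show ?thesis
    unfolding limit_dist_def by (intro borel_measurable_limsup)
qed

text \<open>Let \<open>\<delta>\<close> be the least positive distance between the \<open>\<nu> j\<close>. Once the steps and the distance to the family
  are below \<open>\<delta> / 4\<close>, a sequence near \<open>\<nu> j\<close> is after one step within \<open>\<delta> / 2\<close> of \<open>\<nu> j\<close> and within \<open>\<delta> / 4\<close> of
  some \<open>\<nu> i\<close>, which forces \<open>\<nu> i\<close> and \<open>\<nu> j\<close> to be at distance 0. So it never leaves \<open>\<nu> j\<close>.\<close>
lemma wdist_tendsto_one_of_finitely_many:
  fixes e :: "nat \<Rightarrow> 'a measure" and N :: nat
  assumes e: "\<And>n. n > 0 \<Longrightarrow> e n \<in> prob_measures" and \<nu>: "\<And>j. j < N \<Longrightarrow> \<nu> j \<in> prob_measures"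
    and step: "(\<lambda>n. wdist (e n) (e (Suc n))) \<longlonglongrightarrow> 0"
    and near: "\<And>\<epsilon>. \<epsilon> > 0 \<Longrightarrow> \<forall>\<^sub>F n in sequentially. \<exists>j<N. wdist (e n) (\<nu> j) < \<epsilon>"
  shows "\<exists>j<N. (\<lambda>n. wdist (e n) (\<nu> j)) \<longlonglongrightarrow> 0"
proof -
  note tri = wdist_triangle and comm = wdist_commute
    and nonneg = wdist_nonneg
  define P where "P = {wdist (\<nu> i) (\<nu> j) | i j. i < N \<and> j < N} \<inter> {0<..}"
  have "finite ((\<lambda>(i, j). wdist (\<nu> i) (\<nu> j)) ` ({..<N} \<times> {..<N}))" by simp
  then have fin: "finite (insert 1 P)"
    by (rule rev_finite_subset[THEN finite.insertI]) (auto simp: P_def)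
  define \<delta> where "\<delta> = Min (insert 1 P)"
  have "\<delta> > 0" using fin by (auto simp: \<delta>_def P_def)
  have sep: "wdist (\<nu> i) (\<nu> j) = 0" if "i < N" "j < N" "wdist (\<nu> i) (\<nu> j) < \<delta>" for i j
  proof (rule ccontr)
    assume "wdist (\<nu> i) (\<nu> j) \<noteq> 0"
    then have "wdist (\<nu> i) (\<nu> j) \<in> P"
      using that nonneg[OF \<nu> \<nu>, of i j] by (auto simp: P_def)
    then have "\<delta> \<le> wdist (\<nu> i) (\<nu> j)" unfolding \<delta>_def using fin by (intro Min_le) auto
    then show False using that by simp
  qed
  have same: "wdist (e n) (\<nu> i) = wdist (e n) (\<nu> j)"
    if "i < N" "j < N" "n > 0" "wdist (e n) (\<nu> i) + wdist (e n) (\<nu> j) < \<delta>" for n i j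
  proof -
    have "wdist (\<nu> i) (\<nu> j) = 0"
      using tri[OF \<nu> e \<nu>, of i n j] comm[OF \<nu> e, of i n] that by (intro sep) auto
    then show ?thesis
      using tri[OF e \<nu> \<nu>, of n i j] tri[OF e \<nu> \<nu>, of n j i] comm[OF \<nu> \<nu>, of i j] that by auto
  qed
  have "\<forall>\<^sub>F n in sequentially. 0 < n \<and> wdist (e n) (e (Suc n)) < \<delta> / 4 \<and> (\<exists>j<N. wdist (e n) (\<nu> j) < \<delta> / 4)"
    using near[of "\<delta> / 4"] order_tendstoD(2)[OF step, of "\<delta> / 4"] \<open>\<delta> > 0\<close>
    by (intro eventually_conj) (auto simp: eventually_gt_at_top)
  then obtain n0 where n0: "\<And>n. n \<ge> n0 \<Longrightarrow> 0 < n"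
    "\<And>n. n \<ge> n0 \<Longrightarrow> wdist (e n) (e (Suc n)) < \<delta> / 4"
    "\<And>n. n \<ge> n0 \<Longrightarrow> \<exists>j<N. wdist (e n) (\<nu> j) < \<delta> / 4"
    unfolding eventually_sequentially by blast
  obtain j where j: "j < N" "wdist (e n0) (\<nu> j) < \<delta> / 4" using n0(3) by blast
  have stay: "wdist (e n) (\<nu> j) < \<delta> / 4" if "n \<ge> n0" for n
    using that
  proof (induction n rule: dec_induct)
    case (step n)
    have n: "n > 0" using n0(1) step by simp
    obtain i where i: "i < N" "wdist (e (Suc n)) (\<nu> i) < \<delta> / 4"
      using n0(3)[of "Suc n"] step by auto
    have "wdist (e (Suc n)) (\<nu> j) \<le> wdist (e n) (e (Suc n)) + wdist (e n) (\<nu> j)"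
      using tri[OF e e \<nu>, of "Suc n" n j] comm[OF e e, of n "Suc n"] n j by simp
    then have "wdist (e (Suc n)) (\<nu> j) < \<delta> / 2"
      using n0(2)[of n] step by simp
    then have "wdist (e (Suc n)) (\<nu> i) = wdist (e (Suc n)) (\<nu> j)"
      using i j \<open>\<delta> > 0\<close> by (intro same) auto
    then show ?case using i by simp
  qed (use j in simp)
  have "(\<lambda>n. wdist (e n) (\<nu> j)) \<longlonglongrightarrow> 0"
  proof (rule order_tendstoI)
    fix a :: real assume "a < 0"
    then have "a < wdist (e n) (\<nu> j)" if "0 < n" for n
      using nonneg[OF e[OF that] \<nu>[OF j(1)]] by simp
    with eventually_gt_at_top[of "0::nat"]
    show "\<forall>\<^sub>F n in sequentially. a < wdist (e n) (\<nu> j)"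
      by (rule eventually_mono)
  next
    fix a :: real assume "0 < a"
    then have "\<forall>\<^sub>F n in sequentially. \<exists>i<N. wdist (e n) (\<nu> i) < min a (\<delta> / 4)"
      using \<open>\<delta> > 0\<close> by (intro near) auto
    then show "\<forall>\<^sub>F n in sequentially. wdist (e n) (\<nu> j) < a"
      using eventually_ge_at_top[of n0]
    proof eventually_elim
      case (elim n)
      then obtain i where "i < N" "wdist (e n) (\<nu> i) < a" "wdist (e n) (\<nu> i) < \<delta> / 4" by auto
      moreover have "wdist (e n) (\<nu> i) = wdist (e n) (\<nu> j)"
        using calculation stay[of n] elim n0(1)[of n] j \<open>\<delta> > 0\<close> by (intro same) auto
      ultimately show ?case by simp
    qed
  qed
  then show ?thesis using j by blast
qed

text \<open>A vanishing limit distance only says that the empirical measures approach the family as a set; that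
  they settle at one member is due to the vanishing steps along the orbit.\<close>
lemma limit_dist_eq_0_iff:
  assumes \<nu>: "\<And>j. j < N \<Longrightarrow> \<nu> j \<in> prob_measures"
  shows "limit_dist f N \<nu> (x :: 'a) = 0 \<longleftrightarrow> (\<exists>j<N. x \<in> basin f (\<nu> j))"
proof
  assume 0: "limit_dist f N \<nu> x = 0"
  have "(\<lambda>n. wdist (empirical f n x) (empirical f (Suc n) x)) \<longlonglongrightarrow> 0"
  proof (rule tendsto_sandwich[OF _ _ tendsto_const])
    show "\<forall>\<^sub>F n in sequentially. 0 \<le> wdist (empirical f n x) (empirical f (Suc n) x)"
      using eventually_gt_at_top[of "0::nat"]
      by (rule eventually_mono) (auto intro!: wdist_nonneg empirical_in_prob_measures)
    show "\<forall>\<^sub>F n in sequentially. wdist (empirical f n x) (empirical f (Suc n) x)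
      \<le> diameter (UNIV :: 'a set) / real (Suc n)"
      using eventually_gt_at_top[of "0::nat"]
      by (rule eventually_mono) (rule wdist_empirical_step)
    show "(\<lambda>n. diameter (UNIV :: 'a set) / real (Suc n)) \<longlonglongrightarrow> 0"
      by (rule LIMSEQ_Suc[OF lim_const_over_n])
  qed
  moreover have "\<forall>\<^sub>F n in sequentially. \<exists>j<N. wdist (empirical f n x) (\<nu> j) < \<epsilon>" if "\<epsilon> > 0" for \<epsilon>
  proof -
    have "limit_dist f N \<nu> x < ennreal \<epsilon>" using 0 that by simp
    then show ?thesis
      unfolding limit_dist_def
      by (rule Limsup_lessD[THEN eventually_mono]) (unfold INF_less_iff, meson ennreal_leI lessThan_iff not_le)
  qed
  ultimately have "\<exists>j<N. (\<lambda>n. wdist (empirical f n x) (\<nu> j)) \<longlonglongrightarrow> 0"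
    using empirical_in_prob_measures \<nu> by (intro wdist_tendsto_one_of_finitely_many)
  then show "\<exists>j<N. x \<in> basin f (\<nu> j)"
    by (simp add: basin_def)
next
  assume "\<exists>j<N. x \<in> basin f (\<nu> j)"
  then obtain j where j: "j < N" "(\<lambda>n. wdist (empirical f n x) (\<nu> j)) \<longlonglongrightarrow> 0"
    by (auto simp: basin_def)
  have "limit_dist f N \<nu> x \<le> limsup (\<lambda>n. ennreal (wdist (empirical f n x) (\<nu> j)))"
    unfolding limit_dist_def using j(1) by (intro Limsup_mono always_eventually allI INF_lower) auto
  also have "\<dots> = 0"
    using tendsto_ennrealI[OF j(2)] by (intro lim_imp_Limsup) auto
  finally show "limit_dist f N \<nu> x = 0" by simp
qed

lemma limit_dist_perturb:
  assumes \<nu>: "\<And>j. j < N \<Longrightarrow> \<nu> j \<in> prob_measures" and \<nu>': "\<And>j. j < N \<Longrightarrow> \<nu>' j \<in> prob_measures"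
    and le: "\<And>j. j < N \<Longrightarrow> wdist (\<nu> j) (\<nu>' j) \<le> c" and "0 \<le> c"
  shows "limit_dist f N \<nu>' (x :: 'a) \<le> ennreal c + limit_dist f N \<nu> x"
proof -
  have "(INF j\<in>{..<N}. ennreal (wdist (empirical f n x) (\<nu>' j)))
    \<le> ennreal c + (INF j\<in>{..<N}. ennreal (wdist (empirical f n x) (\<nu> j)))" if "n > 0" for n
  proof (cases "N = 0")
    case False
    let ?A = "(\<lambda>j. ennreal (wdist (empirical f n x) (\<nu> j))) ` {..<N}"
    have "Inf ?A \<in> ?A"
      using False by (subst Min_Inf[symmetric]) (auto intro!: Min_in)
    then obtain j where j: "j < N" "Inf ?A = ennreal (wdist (empirical f n x) (\<nu> j))"
      by auto
    note e = empirical_in_prob_measures[OF that]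
    have "(INF j\<in>{..<N}. ennreal (wdist (empirical f n x) (\<nu>' j))) \<le> ennreal (wdist (empirical f n x) (\<nu>' j))"
      using j(1) by (intro INF_lower) auto
    also have "\<dots> \<le> ennreal (c + wdist (empirical f n x) (\<nu> j))"
      using wdist_triangle[OF e \<nu> \<nu>', of j j f x] j(1) le[OF j(1)] by (intro ennreal_leI) simp
    also have "\<dots> = ennreal c + Inf ?A"
      using wdist_nonneg[OF e \<nu>[OF j(1)]] \<open>0 \<le> c\<close> by (simp add: j(2) ennreal_plus)
    finally show ?thesis .
  qed simp
  with eventually_gt_at_top[of "0::nat"]
  have "limit_dist f N \<nu>' x \<le> limsup (\<lambda>n. ennreal c + (INF j\<in>{..<N}. ennreal (wdist (empirical f n x) (\<nu> j))))"
    unfolding limit_dist_def by (intro Limsup_mono) (rule eventually_mono)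
  then show ?thesis
    unfolding limit_dist_def by (simp add: Limsup_const_add)
qed

text \<open>As far as the size of the family is concerned, covering almost every point by basins exactly is
  the same as doing so approximately for all small \<open>\<epsilon>\<close>, by compactness of the space of measures.\<close>
lemma basins_cover_iff:
  assumes \<mu>: "\<mu> \<in> prob_measures" and f: "f \<in> borel \<rightarrow>\<^sub>M (borel :: 'a measure)"
  shows "(\<exists>\<nu>. basins_cover f \<mu> N \<nu>) \<longleftrightarrow> Limsup (at_right 0) (metric_emergence2 f \<mu>) \<le> enat N"
proof
  interpret prob_space \<mu> using prob_measuresD[OF \<mu>] by simp
  have \<mu>_sets[measurable_cong]: "sets \<mu> = sets borel"
    using prob_measuresD[OF \<mu>] by simp
  {
    assume "\<exists>\<nu>. basins_cover f \<mu> N \<nu>"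
    then obtain \<nu> where \<nu>: "\<forall>j<N. \<nu> j \<in> prob_measures" and "AE x in \<mu>. \<exists>j<N. x \<in> basin f (\<nu> j)"
      by (auto simp: basins_cover_def)
    then have "AE x in \<mu>. limit_dist f N \<nu> x = 0"
      using limit_dist_eq_0_iff[of N \<nu> f] by simp
    then have "(\<integral>\<^sup>+x. limit_dist f N \<nu> x \<partial>\<mu>) = (\<integral>\<^sup>+x. 0 \<partial>\<mu>)"
      by (rule nn_integral_cong_AE)
    then have "metric_emergence2 f \<mu> \<epsilon> \<le> enat N" if "\<epsilon> > 0" for \<epsilon>
      using \<nu> that unfolding metric_emergence2_le_iff[OF \<mu>] by (intro exI[of _ \<nu>]) simp
    then show "Limsup (at_right 0) (metric_emergence2 f \<mu>) \<le> enat N"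
      by (intro Limsup_bounded eventually_mono[OF eventually_at_right_less[of 0]])
  next
    assume "Limsup (at_right 0) (metric_emergence2 f \<mu>) \<le> enat N"
    then have "\<forall>\<^sub>F \<epsilon> in at_right 0. metric_emergence2 f \<mu> \<epsilon> < enat (Suc N)"
      unfolding Limsup_le_iff by (metis enat_ord_simps(2) lessI)
    then obtain b where b: "b > 0" "\<And>\<epsilon>. 0 < \<epsilon> \<Longrightarrow> \<epsilon> < b \<Longrightarrow> metric_emergence2 f \<mu> \<epsilon> < enat (Suc N)"
      unfolding eventually_at_right_field by auto
    have "\<exists>\<nu>. (\<forall>j<N. \<nu> j \<in> prob_measures) \<and> (\<integral>\<^sup>+x. limit_dist f N \<nu> x \<partial>\<mu>) \<le> ennreal (1 / real (Suc k))" for k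
    proof -
      define \<epsilon> where "\<epsilon> = min (b / 2) (1 / real (Suc k))"
      have "0 < \<epsilon>" "\<epsilon> < b" using b(1) by (auto simp: \<epsilon>_def)
      then have "metric_emergence2 f \<mu> \<epsilon> \<le> enat N"
        using b(2)[of \<epsilon>] by (cases "metric_emergence2 f \<mu> \<epsilon>") auto
      then obtain \<nu> where "\<forall>j<N. \<nu> j \<in> prob_measures" "(\<integral>\<^sup>+x. limit_dist f N \<nu> x \<partial>\<mu>) < ennreal \<epsilon>"
        unfolding metric_emergence2_le_iff[OF \<mu>] by auto
      moreover have "ennreal \<epsilon> \<le> ennreal (1 / real (Suc k))"
        by (intro ennreal_leI) (simp add: \<epsilon>_def)
      ultimately show ?thesis by (meson order.strict_implies_order order_less_le_trans)
    qed
    then obtain \<nu> where \<nu>: "\<And>k j. j < N \<Longrightarrow> \<nu> k j \<in> prob_measures"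
      and small: "\<And>k. (\<integral>\<^sup>+x. limit_dist f N (\<nu> k) x \<partial>\<mu>) \<le> ennreal (1 / real (Suc k))"
      by metis
    obtain r \<nu>' where r: "strict_mono r" and \<nu>': "\<And>j. j < N \<Longrightarrow> \<nu>' j \<in> prob_measures"
      and conv: "\<And>j. j < N \<Longrightarrow> (\<lambda>k. wdist (\<nu> (r k) j) (\<nu>' j)) \<longlonglongrightarrow> 0"
      using prob_measures_seq_compact_family[of N "\<lambda>j k. \<nu> k j"] \<nu> by metis
    define c where "c k = (\<Sum>j<N. wdist (\<nu> (r k) j) (\<nu>' j))" for k
    have nonneg: "0 \<le> wdist (\<nu> (r k) j) (\<nu>' j)" if "j < N" for k j
      using wdist_nonneg[OF \<nu>[OF that] \<nu>'[OF that]] .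
    have c_nonneg: "0 \<le> c k" for k
      unfolding c_def using nonneg by (intro sum_nonneg) auto
    have c_ge: "wdist (\<nu> (r k) j) (\<nu>' j) \<le> c k" if "j < N" for k j
      unfolding c_def using that nonneg by (intro member_le_sum) auto
    have meas: "limit_dist f N \<rho> \<in> borel_measurable \<mu>" if "\<And>j. j < N \<Longrightarrow> \<rho> j \<in> prob_measures" for \<rho>
      using limit_dist_measurable[OF f that] by (simp cong: measurable_cong_sets)
    have "(\<integral>\<^sup>+x. limit_dist f N \<nu>' x \<partial>\<mu>) \<le> ennreal (c k + 1 / real (Suc k))" for k
    proof -
      have "(\<integral>\<^sup>+x. limit_dist f N \<nu>' x \<partial>\<mu>) \<le> (\<integral>\<^sup>+x. ennreal (c k) + limit_dist f N (\<nu> (r k)) x \<partial>\<mu>)"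
        using limit_dist_perturb[OF \<nu> \<nu>' c_ge c_nonneg] by (intro nn_integral_mono)
      also have "\<dots> = ennreal (c k) + (\<integral>\<^sup>+x. limit_dist f N (\<nu> (r k)) x \<partial>\<mu>)"
        using meas[OF \<nu>] by (subst nn_integral_add) (auto simp: emeasure_space_1)
      also have "\<dots> \<le> ennreal (c k) + ennreal (1 / real (Suc (r k)))"
        by (intro add_left_mono small)
      also have "\<dots> \<le> ennreal (c k) + ennreal (1 / real (Suc k))"
        using strict_mono_imp_increasing[OF r, of k]
        by (intro add_left_mono ennreal_leI) (simp add: frac_le)
      finally show ?thesis using c_nonneg by (simp add: ennreal_plus)
    qed
    moreover have "(\<lambda>k. ennreal (c k + 1 / real (Suc k))) \<longlonglongrightarrow> ennreal (0 + 0)"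
      unfolding c_def
      by (intro tendsto_ennrealI tendsto_add LIMSEQ_Suc[OF lim_1_over_n] tendsto_null_sum conv) auto
    ultimately have "(\<integral>\<^sup>+x. limit_dist f N \<nu>' x \<partial>\<mu>) \<le> 0"
      by (intro LIMSEQ_le_const[where X = "\<lambda>k. ennreal (c k + 1 / real (Suc k))"]) auto
    then have "AE x in \<mu>. limit_dist f N \<nu>' x = 0"
      using nn_integral_0_iff_AE[OF meas[OF \<nu>']] by simp
    then show "\<exists>\<nu>. basins_cover f \<mu> N \<nu>"
      using \<nu>' limit_dist_eq_0_iff[OF \<nu>', where f = f] by (intro exI[of _ \<nu>']) (simp add: basins_cover_def)
  }
qed

end

theorem theorem1p4:
  fixes f :: "'a::metric_space \<Rightarrow> 'a" and \<mu> :: "'a measure" and N :: nat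
  assumes "compact (UNIV :: 'a set)"
    and "\<mu> \<in> prob_measures"
    and "f \<in> borel \<rightarrow>\<^sub>M borel"
    and "Limsup (at_right 0) (metric_emergence2 f \<mu>) = enat N"
  shows "(\<exists>\<nu>. inj_on \<nu> {..<N} \<and> basins_cover f \<mu> N \<nu>) \<and>
         (\<forall>m<N. \<not> (\<exists>\<nu>. basins_cover f \<mu> m \<nu>))"
proof -
  have iff: "(\<exists>\<nu>. basins_cover f \<mu> m \<nu>) \<longleftrightarrow> N \<le> m" for m
    using basins_cover_iff[OF assms(1-3), of m] assms(4) by simp
  obtain \<nu> where \<nu>: "basins_cover f \<mu> N \<nu>" using iff[of N] by auto
  obtain \<nu>' where \<nu>': "bij_betw \<nu>' {..<card (\<nu> ` {..<N})} (\<nu> ` {..<N})"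
    using ex_bij_betw_nat_finite[of "\<nu> ` {..<N}"] by (auto simp: atLeast0LessThan)
  \<comment> \<open>Listing the members of \<open>\<nu>\<close> without repetition gives a cover too, so minimality of \<open>N\<close> makes \<open>\<nu>\<close> injective.\<close>
  have "(\<exists>j<card (\<nu> ` {..<N}). x \<in> basin f (\<nu>' j)) \<longleftrightarrow> (\<exists>j<N. x \<in> basin f (\<nu> j))" for x
    using bij_betw_imp_surj_on[OF \<nu>'] by (metis (no_types, opaque_lifting) imageE imageI lessThan_iff)
  moreover have "\<nu>' j \<in> prob_measures" if "j < card (\<nu> ` {..<N})" for j
    using bij_betw_apply[OF \<nu>', of j] that \<nu> by (auto simp: basins_cover_def)
  ultimately have "basins_cover f \<mu> (card (\<nu> ` {..<N})) \<nu>'"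
    using \<nu> by (simp add: basins_cover_def)
  then have "N \<le> card (\<nu> ` {..<N})" using iff by blast
  then have "inj_on \<nu> {..<N}"
    using card_image_le[of "{..<N}" \<nu>] by (intro eq_card_imp_inj_on) auto
  then show ?thesis using \<nu> iff by (meson not_le)
qed

end
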